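(* Let $\mathfrak i$ be an ideal in a finite-dimensional real Lie algebra $(\mathfrak g,\mu_{\mathfrak g})$ and let $\sigma\colon\mathfrak g/\mathfrak i\to\mathfrak g$ be a linear splitting of $0\to\mathfrak i\to\mathfrak g\to\mathfrak g/\mathfrak i\to0$. Let $\phi\in\mathfrak i^*\otimes\mathfrak g/\mathfrak i$ and $\mu'\in\wedge^2\mathfrak g^*\otimes\mathfrak g$. Define $\mathrm{ad}'\in\wedge^1\mathfrak g^*\otimes\mathfrak{gl}(\mathfrak g)$ by $\mathrm{ad}'_x(y)=\mu'(x,y)$ for $x,y\in\mathfrak g$, and set $\mathfrak i'=\mathrm{graph}(\sigma\circ\phi)=\{u+\sigma(\phi(u))\mid u\in\mathfrak i\}$. Then the pair $(\mu',\mathfrak i')$ is a simultaneous small deformation of $(\mu_{\mathfrak g},\mathfrak i)$ if and only if $(\mu',\mathrm{ad}',\phi)$ is a Maurer–Cartan element of the $L_\infty[1]$-algebra $\big(\mathbf g[1]\oplus\mathfrak a,\widetilde m_1,\widetilde m_2,\widetilde m_3\big)$ defined in the context.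
   Context: A simultaneous small deformation of $(\mu_{\mathfrak g},\mathfrak i)$ (relative to $\sigma$) is a pair $(\mu',\mathfrak i')$ with $\mu'\in\wedge^2\mathfrak g^*\otimes\mathfrak g$ and $\mathfrak i'\subseteq\mathfrak g$ a subspace such that $\mu_{\mathfrak g}+\mu'$ is a Lie bracket on $\mathfrak g$, $\mathfrak g=\mathfrak i'\oplus\sigma(\mathfrak g/\mathfrak i)$, and $\mathfrak i'$ is an ideal in $(\mathfrak g,\mu_{\mathfrak g}+\mu')$. Notation: $C^k(\mathfrak g;V)=\wedge^k\mathfrak g^*\otimes V$; $\pi_{\mathfrak g/\mathfrak i}$ the projection; $\mathrm{pr}_\sigma(x)=x-\sigma(\pi_{\mathfrak g/\mathfrak i}(x))\in\mathfrak i$; $S_{(a,b)}$ the permutations of $a+b$ letters increasing on the first $a$ and on the last $b$. Graded Lie algebra $\mathbf g=C^\bullet(\mathfrak g;\mathfrak g)[1]\oplus C^\bullet(\mathfrak g;\mathfrak{gl}(\mathfrak g))$: degree $p$ part is $C^{p+1}(\mathfrak g;\mathfrak g)\oplus C^p(\mathfrak g;\mathfrak{gl}(\mathfrak g))$ ($p\ge0$), and $\mathfrak g$ in degree $-1$. For $\xi,\xi'$ in the first summand of degrees $p,p'$ and $\eta,\eta'$ in the second of degrees $q,q'$: $[\![\xi,\xi']\!]=(-1)^{pp'}\xi\circ\xi'-\xi'\circ\xi$; $[\![\xi,\eta]\!]=-\eta\circ\xi$ if $q\ge1$ and $0$ if $q=0$; $[\![\eta,\eta']\!]=(-1)^{qq'}\eta\circ\eta'-\eta'\circ\eta$;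 extended by graded skew-symmetry, where $(\xi\circ\xi')(x_1,\dots,x_{p+p'+1})=\sum_{\tau\in S_{(p'+1,p)}}(-1)^\tau\xi(\xi'(x_{\tau(1)},\dots,x_{\tau(p'+1)}),x_{\tau(p'+2)},\dots)$, $(\eta\circ\xi)(x_1,\dots,x_{p+q})=\sum_{\tau\in S_{(p+1,q-1)}}(-1)^\tau\eta(\xi(x_{\tau(1)},\dots,x_{\tau(p+1)}),x_{\tau(p+2)},\dots)$, $(\eta\circ\eta')(x_1,\dots,x_{q+q'})=\sum_{\tau\in S_{(q',q)}}(-1)^\tau\eta(x_{\tau(q'+1)},\dots,x_{\tau(q+q')})\circ\eta'(x_{\tau(1)},\dots,x_{\tau(q')})$. $\mathfrak a=C^\bullet(\mathfrak g;\mathfrak i^*\otimes\mathfrak g/\mathfrak i)$; $\mathbf I\colon\mathfrak a\to\mathbf g$, $\mathbf I(\psi)(x_1,\dots,x_k,y)=\sigma(\psi(x_1,\dots,x_k,\mathrm{pr}_\sigma(y)))$ (in the second summand); $\mathbf P\colon\mathbf g\to\mathfrak a$, $\mathbf P(\xi,\eta)(x_1,\dots,x_k,u)=\pi_{\mathfrak g/\mathfrak i}(\eta(x_1,\dots,x_k,u))$ for $u\in\mathfrak i$. $\mathrm{ad}^{\mathfrak g}\in C^1(\mathfrak g;\mathfrak{gl}(\mathfrak g))$ is the adjoint representation of $(\mathfrak g,\mu_{\mathfrak g})$, $\Theta=\mu_{\mathfrak g}+\mathrm{ad}^{\mathfrak g}$. On $\mathfrak a$: $m_1(a)=\mathbf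 P[\![\Theta,\mathbf I(a)]\!]$, $m_2(a_1,a_2)=\mathbf P[\![[\![\Theta,\mathbf I(a_1)]\!],\mathbf I(a_2)]\!]$. The $L_\infty[1]$-algebra is $\mathbf g[1]\oplus\mathfrak a=C^\bullet(\mathfrak g;\mathfrak g)[2]\oplus C^\bullet(\mathfrak g;\mathfrak{gl}(\mathfrak g))[1]\oplus C^\bullet(\mathfrak g;\mathfrak i^*\otimes\mathfrak g/\mathfrak i)$ with graded symmetric multibrackets, for $x,y\in\mathbf g$ ($|x|$ the degree in $\mathbf g$) and $a,a_1,a_2\in\mathfrak a$: $\widetilde m_1(x+a)=-[\![\Theta,x]\!]+\mathbf P(x)+m_1(a)$, $\widetilde m_2(x,y)=(-1)^{|x|}[\![x,y]\!]$, $\widetilde m_2(x,a)=\mathbf P[\![x,\mathbf I(a)]\!]$, $\widetilde m_2(a_1,a_2)=m_2(a_1,a_2)$, $\widetilde m_3(x,a_1,a_2)=\mathbf P[\![[\![x,\mathbf I(a_1)]\!],\mathbf I(a_2)]\!]$, all other combinations being zero. A Maurer–Cartan element is a degree-$0$ element $z$ with $\widetilde m_1(z)+\frac12\widetilde m_2(z,z)+\frac16\widetilde m_3(z,z,z)=0$. Here $(\mu',\mathrm{ad}',\phi)$ lies in $C^2(\mathfrak g;\mathfrak g)\oplus C^1(\mathfrak g;\mathfrak{gl}(\mathfrak g))\oplus C^0(\mathfrak g;\mathfrak i^*\otimes\mathfrak g/\mathfrak i)$, the degree-$0$ part. *)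

theory Defs
  imports
    "HOL-Analysis.Product_Vector"
    "HOL-Combinatorics.Permutations"
    "HOL-Library.Function_Algebras"
begin

text \<open>
  Function spaces carry the pointwise vector space structure, so that cochains and tuples of
  cochains are elements of a real vector space.
\<close>

instantiation "fun" :: (type, real_vector) real_vector
begin

definition scaleR_fun :: "real \<Rightarrow> ('a \<Rightarrow> 'b) \<Rightarrow> 'a \<Rightarrow> 'b"
  where "scaleR_fun c f = (\<lambda>x. c *\<^sub>R f x)"

instance
  by standard (simp_all add: scaleR_fun_def fun_eq_iff scaleR_add_right scaleR_add_left)

end

lemma scaleR_fun_apply [simp]: "(c *\<^sub>R f) x = c *\<^sub>R f x"
  by (simp add: scaleR_fun_def)


section \<open>Cochains\<close>

text \<open>
  A \<open>k\<close>-cochain on \<open>\<gg>\<close> is an alternating multilinear map in \<open>k\<close> arguments. The argument tuple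
  is a list, and the cochain is extended by 0 to lists of any other length; hence
  \<open>cochains k W = {0}\<close> for negative \<open>k\<close>. The values lie in a linear subspace \<open>W\<close>.
\<close>

definition cochains :: "int \<Rightarrow> 'v set \<Rightarrow> ('g::real_vector list \<Rightarrow> 'v::real_vector) set" where
  "cochains k W = {f.
     (\<forall>xs. int (length xs) \<noteq> k \<longrightarrow> f xs = 0) \<and>
     (\<forall>xs j. int (length xs) = k \<and> j < length xs \<longrightarrow> linear (\<lambda>x. f (xs[j := x]))) \<and>
     (\<forall>xs. \<not> distinct xs \<longrightarrow> f xs = 0) \<and>
     (\<forall>xs. f xs \<in> W)}"

abbreviation gl :: "('g::real_vector \<Rightarrow> 'g) set" where
  "gl \<equiv> {A. linear A}"

text \<open>
  Linear maps from the subspace \<open>I\<close> to \<open>'q\<close>, represented by their extension by 0 outside \<open>I\<close>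
  (which is in general not linear). This makes the representing function unique.
\<close>

definition hom_from :: "'g::real_vector set \<Rightarrow> ('g \<Rightarrow> 'q::real_vector) set" where
  "hom_from I = {\<phi>.
     (\<forall>u\<in>I. \<forall>v\<in>I. \<phi> (u + v) = \<phi> u + \<phi> v) \<and>
     (\<forall>c. \<forall>u\<in>I. \<phi> (c *\<^sub>R u) = c *\<^sub>R \<phi> u) \<and>
     (\<forall>u. u \<notin> I \<longrightarrow> \<phi> u = 0)}"

definition cochain0 :: "'v \<Rightarrow> 'g list \<Rightarrow> 'v::real_vector" where
  "cochain0 v xs = (if xs = [] then v else 0)"


section \<open>Lie algebras, ideals and simultaneous small deformations\<close>

definition lie_bracket :: "('g::real_vector list \<Rightarrow> 'g) \<Rightarrow> bool" where
  "lie_bracket \<mu> \<longleftrightarrow> \<mu> \<in> cochains 2 UNIV \<and>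
     (\<forall>x y z. \<mu> [x, \<mu> [y, z]] + \<mu> [y, \<mu> [z, x]] + \<mu> [z, \<mu> [x, y]] = 0)"

definition lie_ideal :: "('g::real_vector list \<Rightarrow> 'g) \<Rightarrow> 'g set \<Rightarrow> bool" where
  "lie_ideal \<mu> I \<longleftrightarrow> subspace I \<and> (\<forall>x. \<forall>u\<in>I. \<mu> [x, u] \<in> I)"

text \<open>
  The quotient \<open>\<gg>/I\<close> is a vector space \<open>'q\<close> with its projection: the sequence
  \<open>0 \<rightarrow> I \<rightarrow> 'g \<rightarrow> 'q \<rightarrow> 0\<close> is exact.
\<close>

definition quotient_projection :: "'g::real_vector set \<Rightarrow> ('g \<Rightarrow> 'q::real_vector) \<Rightarrow> bool" where
  "quotient_projection I \<pi> \<longleftrightarrow> linear \<pi> \<and> surj \<pi> \<and> {x. \<pi> x = 0} = I"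

definition linear_splitting ::
    "('g::real_vector \<Rightarrow> 'q::real_vector) \<Rightarrow> ('q \<Rightarrow> 'g) \<Rightarrow> bool" where
  "linear_splitting \<pi> \<sigma> \<longleftrightarrow> linear \<sigma> \<and> (\<forall>q. \<pi> (\<sigma> q) = q)"

definition direct_sum_decomposition :: "'g::real_vector set \<Rightarrow> 'g set \<Rightarrow> bool" where
  "direct_sum_decomposition U V \<longleftrightarrow>
     subspace U \<and> subspace V \<and> U \<inter> V = {0} \<and> {u + v | u v. u \<in> U \<and> v \<in> V} = UNIV"

definition simultaneous_small_deformation ::
    "('g::real_vector list \<Rightarrow> 'g) \<Rightarrow> ('q::real_vector \<Rightarrow> 'g) \<Rightarrow> ('g list \<Rightarrow> 'g) \<Rightarrow> 'g set \<Rightarrow> bool"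
  where
  "simultaneous_small_deformation \<mu> \<sigma> \<mu>' I' \<longleftrightarrow>
     \<mu>' \<in> cochains 2 UNIV \<and> subspace I' \<and>
     lie_bracket (\<mu> + \<mu>') \<and>
     direct_sum_decomposition I' (range \<sigma>) \<and>
     lie_ideal (\<mu> + \<mu>') I'"

text \<open>The 1-cochain \<open>x \<mapsto> \<mu>(x, \<cdot>)\<close> with values in \<open>gl\<close>.\<close>

definition adjoint_cochain :: "('g::real_vector list \<Rightarrow> 'g) \<Rightarrow> 'g list \<Rightarrow> 'g \<Rightarrow> 'g" where
  "adjoint_cochain \<mu> xs = (if length xs = 1 then (\<lambda>y. \<mu> [xs ! 0, y]) else 0)"


section \<open>The graded Lie algebra\<close>

text \<open>
  Permutations of \<open>{0, ..., a + b - 1}\<close> increasing on the first \<open>a\<close> and on the last \<open>b\<close> letters.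
\<close>

definition shuffle_perms :: "nat \<Rightarrow> nat \<Rightarrow> (nat \<Rightarrow> nat) set" where
  "shuffle_perms a b = {\<tau>. \<tau> permutes {..<a + b} \<and>
     strict_mono_on {..<a} \<tau> \<and> strict_mono_on {a..<a + b} \<tau>}"

text \<open>
  \<open>insertion k l f g\<close> inserts the \<open>l\<close>-cochain \<open>g\<close> into the first slot of the \<open>k\<close>-cochain \<open>f\<close>;
  it is 0 if \<open>f\<close> has no arguments. Taking \<open>f\<close> with values in \<open>\<gg>\<close> and in \<open>gl\<close> gives
  \<open>\<xi> \<circ> \<xi>'\<close> and \<open>\<eta> \<circ> \<xi>\<close>, respectively.
\<close>

definition insertion ::
    "nat \<Rightarrow> nat \<Rightarrow> ('g list \<Rightarrow> 'v::real_vector) \<Rightarrow> ('g list \<Rightarrow> 'g) \<Rightarrow> 'g list \<Rightarrow> 'v" where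
  "insertion k l f g xs =
     (if 1 \<le> k \<and> length xs = l + (k - 1)
      then \<Sum>\<tau>\<in>shuffle_perms l (k - 1). of_int (sign \<tau>) *\<^sub>R
             f (g (map (\<lambda>j. xs ! \<tau> j) [0..<l]) # map (\<lambda>j. xs ! \<tau> j) [l..<l + (k - 1)])
      else 0)"

text \<open>\<open>\<eta> \<circ> \<eta>'\<close> for a \<open>k\<close>-cochain \<open>\<eta>\<close> and an \<open>l\<close>-cochain \<open>\<eta>'\<close> with values in \<open>gl\<close>.\<close>

definition gl_comp ::
    "nat \<Rightarrow> nat \<Rightarrow> ('g list \<Rightarrow> 'g \<Rightarrow> 'g::real_vector) \<Rightarrow> ('g list \<Rightarrow> 'g \<Rightarrow> 'g) \<Rightarrow>
     'g list \<Rightarrow> 'g \<Rightarrow> 'g" where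
  "gl_comp k l \<eta> \<eta>' xs =
     (if length xs = l + k
      then \<Sum>\<tau>\<in>shuffle_perms l k. of_int (sign \<tau>) *\<^sub>R
             (\<eta> (map (\<lambda>j. xs ! \<tau> j) [l..<l + k]) \<circ> \<eta>' (map (\<lambda>j. xs ! \<tau> j) [0..<l]))
      else 0)"

type_synonym 'g gla = "('g list \<Rightarrow> 'g) \<times> ('g list \<Rightarrow> 'g \<Rightarrow> 'g)"

definition gla_degree :: "int \<Rightarrow> 'g::real_vector gla set" where
  "gla_degree p = cochains (p + 1) UNIV \<times> cochains p gl"

definition koszul :: "int \<Rightarrow> real" where
  "koszul n = (if even n then 1 else - 1)"

text \<open>
  The bracket of homogeneous elements of degrees \<open>p\<close> and \<open>p'\<close>. An element of degree \<open>p\<close> consists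
  of a \<open>(p + 1)\<close>-cochain and a \<open>p\<close>-cochain (the latter being 0 for \<open>p = -1\<close>). The summand
  \<open>gla_mixed p p' \<xi> \<eta>'\<close> is the bracket of \<open>\<xi>\<close> with \<open>\<eta>'\<close>; the bracket of \<open>\<eta>\<close> with \<open>\<xi>'\<close> is
  determined by graded skew-symmetry.
\<close>

definition gla_mixed ::
    "int \<Rightarrow> int \<Rightarrow> ('g list \<Rightarrow> 'g) \<Rightarrow> ('g list \<Rightarrow> 'g \<Rightarrow> 'g::real_vector) \<Rightarrow> 'g list \<Rightarrow> 'g \<Rightarrow> 'g" where
  "gla_mixed p q \<xi> \<eta> = (if 1 \<le> q then - insertion (nat q) (nat (p + 1)) \<eta> \<xi> else 0)"

definition gla_bracket :: "int \<Rightarrow> int \<Rightarrow> 'g::real_vector gla \<Rightarrow> 'g gla \<Rightarrow> 'g gla" where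
  "gla_bracket p p' x x' = (case x of (\<xi>, \<eta>) \<Rightarrow> case x' of (\<xi>', \<eta>') \<Rightarrow>
     (koszul (p * p') *\<^sub>R insertion (nat (p + 1)) (nat (p' + 1)) \<xi> \<xi>'
        - insertion (nat (p' + 1)) (nat (p + 1)) \<xi>' \<xi>,
      gla_mixed p p' \<xi> \<eta>'
        - koszul (p * p') *\<^sub>R gla_mixed p' p \<xi>' \<eta>
        + (koszul (p * p') *\<^sub>R gl_comp (nat p) (nat p') \<eta> \<eta>' - gl_comp (nat p') (nat p) \<eta>' \<eta>)))"

text \<open>The degree 1 element \<open>\<Theta> = \<mu> + ad\<close>.\<close>

definition Theta :: "('g::real_vector list \<Rightarrow> 'g) \<Rightarrow> 'g gla" where
  "Theta \<mu> = (\<mu>, adjoint_cochain \<mu>)"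


section \<open>The \<open>L\<^sub>\<infinity>[1]\<close>-algebra\<close>

text \<open>\<open>incl_I\<close> and \<open>proj_P\<close> are the degree 0 maps \<open>\<^bold>I\<close> and \<open>\<^bold>P\<close>.\<close>

definition pr_split :: "('g::real_vector \<Rightarrow> 'q) \<Rightarrow> ('q \<Rightarrow> 'g) \<Rightarrow> 'g \<Rightarrow> 'g" where
  "pr_split \<pi> \<sigma> x = x - \<sigma> (\<pi> x)"

definition incl_I ::
    "('g::real_vector \<Rightarrow> 'q) \<Rightarrow> ('q \<Rightarrow> 'g) \<Rightarrow> ('g list \<Rightarrow> 'g \<Rightarrow> 'q) \<Rightarrow> 'g gla" where
  "incl_I \<pi> \<sigma> \<psi> = (0, \<lambda>xs y. \<sigma> (\<psi> xs (pr_split \<pi> \<sigma> y)))"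

definition proj_P ::
    "'g set \<Rightarrow> ('g \<Rightarrow> 'q::real_vector) \<Rightarrow> 'g gla \<Rightarrow> 'g list \<Rightarrow> 'g \<Rightarrow> 'q" where
  "proj_P I \<pi> x = (\<lambda>xs u. if u \<in> I then \<pi> (snd x xs u) else 0)"

text \<open>
  The numeric parameters of the brackets below are the degrees of the arguments. An element of
  degree \<open>n\<close> is a pair \<open>(x, a)\<close>, standing for \<open>x + a\<close>, where \<open>x\<close> has degree \<open>n + 1\<close> in the graded
  Lie algebra and \<open>a\<close> is an \<open>n\<close>-cochain with values in \<open>I\<^sup>* \<otimes> \<gg>/I\<close>.
\<close>

type_synonym ('g, 'q) linf = "'g gla \<times> ('g list \<Rightarrow> 'g \<Rightarrow> 'q)"

definition linf_degree :: "'g::real_vector set \<Rightarrow> int \<Rightarrow> ('g, 'q::real_vector) linf set" where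
  "linf_degree I n = gla_degree (n + 1) \<times> cochains n (hom_from I)"

context
  fixes \<mu> :: "'g::real_vector list \<Rightarrow> 'g"
    and I :: "'g set"
    and \<pi> :: "'g \<Rightarrow> 'q::real_vector"
    and \<sigma> :: "'q \<Rightarrow> 'g"
begin

definition m1 :: "int \<Rightarrow> ('g list \<Rightarrow> 'g \<Rightarrow> 'q) \<Rightarrow> 'g list \<Rightarrow> 'g \<Rightarrow> 'q" where
  "m1 n a = proj_P I \<pi> (gla_bracket 1 n (Theta \<mu>) (incl_I \<pi> \<sigma> a))"

text \<open>\<open>bracket_IP p n x a = \<^bold>P[x, \<^bold>I a]\<close> and
  \<open>bracket_IIP p n1 n2 x a1 a2 = \<^bold>P[[x, \<^bold>I a1], \<^bold>I a2]\<close> for \<open>x\<close> of degree \<open>p\<close>.\<close>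

definition bracket_IP :: "int \<Rightarrow> int \<Rightarrow> 'g gla \<Rightarrow> ('g list \<Rightarrow> 'g \<Rightarrow> 'q) \<Rightarrow> 'g list \<Rightarrow> 'g \<Rightarrow> 'q" where
  "bracket_IP p n x a = proj_P I \<pi> (gla_bracket p n x (incl_I \<pi> \<sigma> a))"

definition bracket_IIP :: "int \<Rightarrow> int \<Rightarrow> int \<Rightarrow> 'g gla \<Rightarrow>
    ('g list \<Rightarrow> 'g \<Rightarrow> 'q) \<Rightarrow> ('g list \<Rightarrow> 'g \<Rightarrow> 'q) \<Rightarrow> 'g list \<Rightarrow> 'g \<Rightarrow> 'q" where
  "bracket_IIP p n1 n2 x a1 a2 =
     proj_P I \<pi> (gla_bracket (p + n1) n2 (gla_bracket p n1 x (incl_I \<pi> \<sigma> a1)) (incl_I \<pi> \<sigma> a2))"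

definition m2 :: "int \<Rightarrow> int \<Rightarrow> ('g list \<Rightarrow> 'g \<Rightarrow> 'q) \<Rightarrow> ('g list \<Rightarrow> 'g \<Rightarrow> 'q) \<Rightarrow>
    'g list \<Rightarrow> 'g \<Rightarrow> 'q" where
  "m2 n1 n2 a1 a2 = bracket_IIP 1 n1 n2 (Theta \<mu>) a1 a2"

definition linf_m1 :: "int \<Rightarrow> ('g, 'q) linf \<Rightarrow> ('g, 'q) linf" where
  "linf_m1 n z = (case z of (x, a) \<Rightarrow>
     (- gla_bracket 1 (n + 1) (Theta \<mu>) x, proj_P I \<pi> x + m1 n a))"

text \<open>
  In the next two definitions, the signs that depend on the degrees \<open>n1\<close>, \<open>n2\<close>, \<open>n3\<close> only are
  those of graded symmetry, from moving the Lie algebra entry to the front.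
\<close>

definition linf_m2 :: "int \<Rightarrow> int \<Rightarrow> ('g, 'q) linf \<Rightarrow> ('g, 'q) linf \<Rightarrow> ('g, 'q) linf" where
  "linf_m2 n1 n2 z1 z2 = (case z1 of (x1, a1) \<Rightarrow> case z2 of (x2, a2) \<Rightarrow>
     (koszul (n1 + 1) *\<^sub>R gla_bracket (n1 + 1) (n2 + 1) x1 x2,
      bracket_IP (n1 + 1) n2 x1 a2
        + koszul (n1 * n2) *\<^sub>R bracket_IP (n2 + 1) n1 x2 a1
        + m2 n1 n2 a1 a2))"

definition linf_m3 :: "int \<Rightarrow> int \<Rightarrow> int \<Rightarrow>
    ('g, 'q) linf \<Rightarrow> ('g, 'q) linf \<Rightarrow> ('g, 'q) linf \<Rightarrow> ('g, 'q) linf" where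
  "linf_m3 n1 n2 n3 z1 z2 z3 =
     (case z1 of (x1, a1) \<Rightarrow> case z2 of (x2, a2) \<Rightarrow> case z3 of (x3, a3) \<Rightarrow>
     (0,
      bracket_IIP (n1 + 1) n2 n3 x1 a2 a3
        + koszul (n1 * n2) *\<^sub>R bracket_IIP (n2 + 1) n1 n3 x2 a1 a3
        + koszul (n3 * (n1 + n2)) *\<^sub>R bracket_IIP (n3 + 1) n1 n2 x3 a1 a2))"

definition maurer_cartan :: "('g, 'q) linf \<Rightarrow> bool" where
  "maurer_cartan z \<longleftrightarrow> z \<in> linf_degree I 0 \<and>
     linf_m1 0 z + (1 / 2) *\<^sub>R linf_m2 0 0 z z + (1 / 6) *\<^sub>R linf_m3 0 0 0 z z z = 0"

end

end

theory Submission
  imports Defs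
begin

text \<open>
  Put \<open>\<nu> = \<mu> + \<mu>'\<close>. As \<open>(\<mu>', ad') = \<Theta>(\<mu>')\<close> and \<open>\<Theta>\<close> is additive, the hypotheses on \<open>\<mu>\<close> allow
  both components of the Maurer--Cartan equation of \<open>(\<mu>', ad', \<phi>)\<close> to be rewritten in terms of
  \<open>\<nu>\<close> and \<open>\<phi>\<close> alone.

  The component in \<open>\<^bold>g\<close> is \<open>- [\<Theta>(\<mu>), \<Theta>(\<mu>')] - [\<Theta>(\<mu>'), \<Theta>(\<mu>')] / 2\<close>. As \<open>[\<Theta>(\<mu>), \<Theta>(\<mu>)] = 0\<close> by the
  Jacobi identity of \<open>\<mu>\<close>, polarization turns this into \<open>- [\<Theta>(\<nu>), \<Theta>(\<nu>)] / 2\<close>. The first part of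
  \<open>[\<Theta>(\<nu>), \<Theta>(\<nu>)]\<close> is a nonzero multiple of the Jacobiator of \<open>\<nu>\<close>; the second
  vanishes iff \<open>x \<mapsto> \<nu>(x, \<cdot>)\<close>
  is a representation. Both carry the same information
  (\<open>gla_bracket_Theta\<close>). Hence this component vanishes iff \<open>\<nu>\<close> is a Lie bracket.

  In the component in \<open>\<aa>\<close>, the inclusion of \<open>\<phi>\<close> is the constant endomorphism
  \<open>A = \<sigma> \<circ> \<phi> \<circ> pr\<close>, and bracketing with it is the pointwise commutator with \<open>A\<close>
  (\<open>gla_bracket_cochain0\<close>). Since \<open>A \<circ> A = 0\<close>, the double commutator of \<open>\<nu>(x, \<cdot>)\<close> with \<open>A\<close> is
  \<open>- 2 A \<circ> \<nu>(x, \<cdot>) \<circ> A\<close>. The term \<open>\<pi>(\<mu>(x, u))\<close>, which is absent from the equation, is 0 because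
  \<open>I\<close> is an ideal for \<open>\<mu>\<close>; adding it, the equation becomes
  \<open>\<pi>(\<nu>(x, w)) = \<phi>(pr(\<nu>(x, w)))\<close> with \<open>w = u + \<sigma>(\<phi>(u))\<close> and \<open>u\<close> in \<open>I\<close>. The graph of
  \<open>\<sigma> \<circ> \<phi>\<close> consists precisely of the \<open>y\<close> with \<open>\<pi>(y) = \<phi>(pr(y))\<close> (\<open>graph_eq\<close>), so the equation
  says that the graph is stable under \<open>\<nu>(x, \<cdot>)\<close>. The graph is always a complement of the image
  of \<open>\<sigma>\<close>, so the remaining condition on a deformation is automatic.
\<close>


section \<open>Shuffles of at most three letters\<close>

text \<open>
  Being the identity beyond \<open>n\<close>, such a \<open>\<tau>\<close> is increasing on all of the natural numbers, so that
  \<open>i \<le> \<tau> i\<close> for every \<open>i\<close>.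
\<close>

lemma increasing_permutes_id:
  assumes p: "\<tau> permutes {..<n::nat}" and m: "strict_mono_on {..<n} \<tau>"
  shows "\<tau> = id"
proof -
  have "strict_mono \<tau>"
  proof (rule strict_monoI)
    fix i j :: nat assume ij: "i < j"
    show "\<tau> i < \<tau> j"
    proof (cases "j < n")
      case True
      then show ?thesis using m ij by (auto simp: strict_mono_on_def)
    next
      case False
      then have "\<tau> j = j" using p by (auto simp: permutes_def)
      moreover have "\<tau> i < j"
        using p ij False permutes_in_image[OF p, of i]
        by (cases "i < n") (auto simp: permutes_def)
      ultimately show ?thesis by simp
    qed
  qed
  then have "i \<le> \<tau> i" for i by (rule strict_mono_imp_increasing)
  then show ?thesis using permutes_natset_ge[OF p] by blast
qed

lemma shuffle_perms_0_right: "shuffle_perms n 0 = {id}"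
  by (auto simp: shuffle_perms_def strict_mono_on_def permutes_id
      intro!: increasing_permutes_id)

lemma shuffle_perms_0_left: "shuffle_perms 0 n = {id}"
  by (auto simp: shuffle_perms_def strict_mono_on_def permutes_id lessThan_atLeast0
      intro!: increasing_permutes_id)

lemma shuffle_perms_1_1: "shuffle_perms 1 1 = {id, transpose 0 1}"
proof -
  have eq: "{..<1 + 1} = {0, 1 :: nat}" by auto
  show ?thesis
    unfolding shuffle_perms_def eq permutes_doubleton_iff
    by (auto simp: strict_mono_on_def)
qed

text \<open>The third shuffle is the cycle \<open>0 \<mapsto> 1 \<mapsto> 2 \<mapsto> 0\<close>.\<close>

lemma shuffle_perms_2_1:
  "shuffle_perms 2 1 = {id, transpose 1 2, transpose 0 1 \<circ> transpose 1 2}" (is "_ = ?S")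
proof
  show "?S \<subseteq> shuffle_perms 2 1"
    by (auto simp: shuffle_perms_def strict_mono_on_def permutes_id transpose_def
        intro!: permutes_compose permutes_swap_id)
  show "shuffle_perms 2 1 \<subseteq> ?S"
  proof
    fix \<tau> assume "\<tau> \<in> shuffle_perms 2 1"
    then have p: "\<tau> permutes {..<3}" and lt: "\<tau> 0 < \<tau> 1"
      by (auto simp: shuffle_perms_def strict_mono_on_def)
    have b: "\<tau> 0 < 3" "\<tau> 1 < 3" "\<tau> 2 < 3"
      using permutes_in_image[OF p] by auto
    have ne: "\<tau> 0 \<noteq> \<tau> 2" "\<tau> 1 \<noteq> \<tau> 2"
      using permutes_inj[OF p] by (simp_all add: inj_eq)
    have fix_other: "\<tau> i = i" if "i \<noteq> 0" "i \<noteq> 1" "i \<noteq> 2" for i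
      using p that by (auto simp: permutes_def)
    from b ne lt consider "\<tau> 0 = 0" "\<tau> 1 = 1" "\<tau> 2 = 2" | "\<tau> 0 = 0" "\<tau> 1 = 2" "\<tau> 2 = 1"
      | "\<tau> 0 = 1" "\<tau> 1 = 2" "\<tau> 2 = 0"
      by linarith
    then show "\<tau> \<in> ?S"
    proof cases
      case 1
      then have "\<tau> = id" using fix_other by (intro ext) (metis id_apply)
      then show ?thesis by simp
    next
      case 2
      then have "\<tau> i = transpose 1 2 i" for i
        using fix_other[of i] by (auto simp: transpose_def)
      then show ?thesis by auto
    next
      case 3
      then have "\<tau> i = (transpose 0 1 \<circ> transpose 1 2) i" for i
        using fix_other[of i] by (auto simp: transpose_def)
      then show ?thesis by blast
    qed
  qed
qed


lemma sum_shuffle_perms_1_1: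
  "sum h (shuffle_perms 1 1) = h id + h (transpose 0 1)"
proof -
  have "id \<noteq> (transpose 0 1 :: nat \<Rightarrow> nat)"
    by (auto simp: fun_eq_iff transpose_def)
  then have "sum h {id, transpose 0 1 :: nat \<Rightarrow> nat} = h id + h (transpose 0 1)"
    by (subst sum.insert) (simp_all only: sum.insert finite.intros insert_iff empty_iff simp_thms
        sum.empty add_0_right)
  then show ?thesis by (simp only: shuffle_perms_1_1)
qed

lemma sum_shuffle_perms_2_1:
  "sum h (shuffle_perms 2 1)
    = h id + h (transpose 1 2) + h (transpose 0 1 \<circ> transpose 1 2)"
proof -
  have "id \<noteq> (transpose 1 2 :: nat \<Rightarrow> nat)" "id \<noteq> (transpose 0 1 \<circ> transpose 1 2 :: nat \<Rightarrow> nat)"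
    "transpose 1 2 \<noteq> (transpose 0 1 \<circ> transpose 1 2 :: nat \<Rightarrow> nat)"
    by (auto simp: fun_eq_iff transpose_def)
  then have "sum h {id, transpose 1 2, transpose 0 1 \<circ> transpose 1 2 :: nat \<Rightarrow> nat}
      = h id + h (transpose 1 2) + h (transpose 0 1 \<circ> transpose 1 2)"
    by (simp only: sum.insert finite.intros insert_iff empty_iff simp_thms sum.empty
        add_0_right add.assoc)
  then show ?thesis by (simp only: shuffle_perms_2_1)
qed

lemma sign_cycle: "sign (transpose 0 (Suc 0) \<circ> transpose (Suc 0) 2 :: nat \<Rightarrow> nat) = 1"
  by (subst sign_compose) (auto simp: permutation_swap_id sign_swap_id)


section \<open>Insertion and composition in low degree\<close>

lemma length_1_cases: "length xs = Suc 0 \<Longrightarrow> \<exists>x. xs = [x]"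
  by (simp add: length_Suc_conv)

lemma length_2_cases: "length xs = 2 \<Longrightarrow> \<exists>x y. xs = [x, y]"
  by (auto simp: length_Suc_conv numeral_2_eq_2)

lemma length_3_cases: "length xs = 3 \<Longrightarrow> \<exists>x y z. xs = [x, y, z]"
  by (auto simp: length_Suc_conv numeral_3_eq_3)

lemma insertion_wrong_length: "length xs \<noteq> l + (k - 1) \<Longrightarrow> insertion k l f g xs = 0"
  by (auto simp: insertion_def)

lemma gl_comp_wrong_length: "length xs \<noteq> l + k \<Longrightarrow> gl_comp k l \<eta> \<eta>' xs = 0"
  by (auto simp: gl_comp_def)

lemma insertion_2_2:
  "insertion 2 2 f g [x, y, z] = f [g [x, y], z] - f [g [x, z], y] + f [g [y, z], x]"
  by (simp add: insertion_def sum_shuffle_perms_2_1[unfolded One_nat_def] sign_swap_id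
      sign_cycle upt_rec transpose_def)

lemma insertion_1_2: "insertion 1 2 f g [x, y] = f [g [x, y]]"
  by (simp add: insertion_def shuffle_perms_0_right upt_rec)

lemma gl_comp_1_1:
  "gl_comp 1 1 \<eta> \<eta>' [x, y] = (\<eta> [y] \<circ> \<eta>' [x]) - (\<eta> [x] \<circ> \<eta>' [y])"
  by (simp add: gl_comp_def sum_shuffle_perms_1_1[unfolded One_nat_def] sign_swap_id
      upt_rec fun_eq_iff)

lemma gl_comp_1_0: "gl_comp 1 0 \<eta> \<eta>' [x] = \<eta> [x] \<circ> \<eta>' []"
  by (simp add: gl_comp_def shuffle_perms_0_left upt_rec fun_eq_iff)

lemma gl_comp_0_1: "gl_comp 0 1 \<eta> \<eta>' [x] = \<eta> [] \<circ> \<eta>' [x]"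
  using shuffle_perms_0_right[of 1]
  by (simp add: gl_comp_def upt_rec fun_eq_iff)

lemma insertion_zero_left: "insertion k l 0 g = 0"
  by (auto simp: insertion_def fun_eq_iff)

lemma insertion_zero_right:
  assumes "\<And>r. f (0 # r) = 0"
  shows "insertion k l f 0 = 0"
  using assms by (auto simp: insertion_def fun_eq_iff)

lemma insertion_add_left: "insertion k l (f + f') g = insertion k l f g + insertion k l f' g"
  by (auto simp: insertion_def fun_eq_iff sum.distrib scaleR_add_right)

lemma insertion_add_right:
  assumes "\<And>x y r. f ((x + y) # r) = f (x # r) + f (y # r)"
  shows "insertion k l f (g + g') = insertion k l f g + insertion k l f g'"
  by (auto simp: insertion_def fun_eq_iff sum.distrib scaleR_add_right assms)


section \<open>Cochains of degree one and two\<close>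

lemma cochains_wrong_length: "f \<in> cochains k W \<Longrightarrow> int (length xs) \<noteq> k \<Longrightarrow> f xs = 0"
  by (simp add: cochains_def)

lemma cochains_linear_head:
  assumes "f \<in> cochains k W" "k = int (Suc (length r))"
  shows "linear (\<lambda>x. f (x # r))"
proof -
  have "int (length xs) = k \<Longrightarrow> j < length xs \<Longrightarrow> linear (\<lambda>x. f (xs[j := x]))" for xs j
    using assms(1) by (simp add: cochains_def)
  from this[of "0 # r" 0] have "linear (\<lambda>x. f ((0 # r)[0 := x]))"
    using assms(2) by simp
  then show ?thesis by simp
qed

lemma cochains_add_head:
  assumes "f \<in> cochains k W"
  shows "f ((x + y) # r) = f (x # r) + f (y # r)"
proof (cases "k = int (Suc (length r))")
  case True
  then show ?thesis using linear_add[OF cochains_linear_head[OF assms]] by blast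
next
  case False
  then show ?thesis by (simp add: cochains_wrong_length[OF assms])
qed

lemma cochains_zero_head:
  assumes "f \<in> cochains k W"
  shows "f (0 # r) = 0"
  using cochains_add_head[OF assms, of 0 0 r] by simp

lemma cochains_2_linear_right:
  assumes "f \<in> cochains 2 W"
  shows "linear (\<lambda>y. f [x, y])"
proof -
  have "int (length xs) = 2 \<Longrightarrow> j < length xs \<Longrightarrow> linear (\<lambda>x. f (xs[j := x]))" for xs j
    using assms by (simp add: cochains_def)
  from this[of "[x, 0]" 1] have "linear (\<lambda>y. f ([x, 0][1 := y]))"
    by simp
  then show ?thesis by simp
qed

lemma cochains_2_skew:
  assumes "f \<in> cochains 2 W"
  shows "f [x, y] = - f [y, x]"
proof -
  have alt: "f [z, z] = 0" for z
    using assms by (simp add: cochains_def)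
  have "0 = f [x + y, x + y]" using alt by simp
  also have "\<dots> = f [x, y] + f [y, x]"
    by (simp add: alt[of x] alt[of y] cochains_add_head[OF assms]
        linear_add[OF cochains_2_linear_right[OF assms]])
  finally show ?thesis by (simp add: eq_neg_iff_add_eq_0)
qed

lemma cochains_UNIV_add:
  assumes "f \<in> cochains k UNIV" "g \<in> cochains k UNIV"
  shows "f + g \<in> cochains k UNIV"
  using assms by (auto simp: cochains_def intro!: linear_compose_add)

lemma adjoint_cochain_in_cochains:
  assumes "\<mu> \<in> cochains 2 UNIV"
  shows "adjoint_cochain \<mu> \<in> cochains 1 gl"
proof -
  have "linear (\<lambda>x. adjoint_cochain \<mu> (xs[j := x]))" if xs: "length xs = 1" "j < length xs" for xs j
  proof -
    obtain a where "xs = [a]" using xs length_1_cases by auto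
    then have "(\<lambda>x. adjoint_cochain \<mu> (xs[j := x])) = (\<lambda>x y. \<mu> [x, y])"
      using xs by (auto simp: adjoint_cochain_def)
    moreover have l: "linear (\<lambda>x. \<mu> [x, y])" for y
      using cochains_linear_head[OF assms, of "[y]"] by simp
    have "linear (\<lambda>x y. \<mu> [x, y])"
      by (intro linearI) (auto simp: fun_eq_iff linear_add[OF l] linear_scale[OF l])
    ultimately show ?thesis by simp
  qed
  moreover have "linear (adjoint_cochain \<mu> xs)" for xs
  proof (cases "length xs = 1")
    case True
    then show ?thesis using cochains_2_linear_right[OF assms] by (simp add: adjoint_cochain_def)
  next
    case False
    then have "adjoint_cochain \<mu> xs = (\<lambda>_. 0)" by (auto simp: adjoint_cochain_def)
    then show ?thesis by (auto intro: linearI)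
  qed
  moreover have "length xs \<noteq> 1" if "\<not> distinct xs" for xs :: "'a list"
    using that length_1_cases[of xs] by auto
  ultimately show ?thesis
    unfolding cochains_def by (auto simp: adjoint_cochain_def)
qed

lemma cochain0_in_cochains:
  assumes "v \<in> W" "0 \<in> W"
  shows "cochain0 v \<in> cochains 0 W"
  using assms by (auto simp: cochains_def cochain0_def)


section \<open>The structure equation in the graded Lie algebra\<close>

text \<open>
  The polarized Jacobiator: the first component has the three terms of the Jacobi identity,
  and the commutator and adjoint terms of the second component are the same three terms, with
  the last argument being the one that the endomorphism acts on.
\<close>

lemma gla_bracket_Theta:
  fixes \<mu> \<nu> :: "'g::real_vector list \<Rightarrow> 'g"
  assumes \<mu>: "\<mu> \<in> cochains 2 UNIV" and \<nu>: "\<nu> \<in> cochains 2 UNIV"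
  defines "K \<equiv> - insertion 2 2 \<mu> \<nu> - insertion 2 2 \<nu> \<mu>"
  shows "gla_bracket 1 1 (Theta \<mu>) (Theta \<nu>)
    = (K, \<lambda>xs. if length xs = 2 then \<lambda>z. K (xs @ [z]) else 0)"
proof -
  let ?G = "snd (gla_bracket 1 1 (Theta \<mu>) (Theta \<nu>))"
  have fst: "fst (gla_bracket 1 1 (Theta \<mu>) (Theta \<nu>)) = K"
    by (simp add: gla_bracket_def Theta_def koszul_def K_def fun_eq_iff)
  have G: "?G = - insertion 1 2 (adjoint_cochain \<nu>) \<mu> - insertion 1 2 (adjoint_cochain \<mu>) \<nu>
      - gl_comp 1 1 (adjoint_cochain \<mu>) (adjoint_cochain \<nu>)
      - gl_comp 1 1 (adjoint_cochain \<nu>) (adjoint_cochain \<mu>)"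
    by (simp add: gla_bracket_def Theta_def koszul_def gla_mixed_def fun_eq_iff)
  have "?G xs = (if length xs = 2 then \<lambda>z. K (xs @ [z]) else 0)" for xs
  proof (cases "length xs = 2")
    case True
    then obtain x y where xs: "xs = [x, y]" using length_2_cases by blast
    have "?G [x, y] z = K [x, y, z]" for z
      unfolding G K_def
      using cochains_2_skew[OF \<mu>, of "\<nu> [x, z]" y] cochains_2_skew[OF \<mu>, of "\<nu> [y, z]" x]
        cochains_2_skew[OF \<nu>, of "\<mu> [x, z]" y] cochains_2_skew[OF \<nu>, of "\<mu> [y, z]" x]
      by (simp add: insertion_2_2 insertion_1_2[unfolded One_nat_def]
          gl_comp_1_1[unfolded One_nat_def] adjoint_cochain_def)
    then show ?thesis by (simp add: xs fun_eq_iff)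
  next
    case False
    then show ?thesis
      unfolding G by (simp add: insertion_wrong_length gl_comp_wrong_length)
  qed
  then show ?thesis using fst by (simp add: prod_eq_iff fun_eq_iff)
qed

lemma lie_bracket_iff_insertion:
  assumes \<mu>: "\<mu> \<in> cochains 2 UNIV"
  shows "lie_bracket \<mu> \<longleftrightarrow> insertion 2 2 \<mu> \<mu> = 0"
proof -
  have jac: "insertion 2 2 \<mu> \<mu> [x, y, z]
      = - (\<mu> [x, \<mu> [y, z]] + \<mu> [y, \<mu> [z, x]] + \<mu> [z, \<mu> [x, y]])" for x y z
  proof -
    have "\<mu> [y, \<mu> [z, x]] = - \<mu> [y, \<mu> [x, z]]"
      using cochains_2_skew[OF \<mu>, of z x] linear_neg[OF cochains_2_linear_right[OF \<mu>]] by simp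
    then show ?thesis
      using cochains_2_skew[OF \<mu>, of "\<mu> [x, z]" y] cochains_2_skew[OF \<mu>, of "\<mu> [y, z]" x]
        cochains_2_skew[OF \<mu>, of "\<mu> [x, y]" z]
      by (simp add: insertion_2_2)
  qed
  have "insertion 2 2 \<mu> \<mu> = 0 \<longleftrightarrow> (\<forall>x y z. insertion 2 2 \<mu> \<mu> [x, y, z] = 0)" (is "?L \<longleftrightarrow> ?R")
  proof
    assume R: ?R
    have "insertion 2 2 \<mu> \<mu> xs = 0" for xs
      using R length_3_cases[of xs] insertion_wrong_length[of xs 2 2 \<mu> \<mu>] by fastforce
    then show ?L by auto
  qed simp
  then show ?thesis
    unfolding lie_bracket_def jac neg_equal_0_iff_equal using \<mu> by blast
qed

text \<open>Polarization of the quadratic map \<open>\<nu> \<mapsto> [\<Theta>(\<nu>), \<Theta>(\<nu>)]\<close> around a solution.\<close>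

lemma structure_equation_iff:
  assumes lie: "lie_bracket \<mu>" and \<nu>: "\<nu> \<in> cochains 2 UNIV"
  shows "gla_bracket 1 1 (Theta \<mu>) (Theta \<nu>)
      + (1 / 2) *\<^sub>R gla_bracket 1 1 (Theta \<nu>) (Theta \<nu>) = 0 \<longleftrightarrow> lie_bracket (\<mu> + \<nu>)"
proof -
  have \<mu>: "\<mu> \<in> cochains 2 UNIV" using lie by (simp add: lie_bracket_def)
  have zero: "insertion 2 2 \<mu> \<mu> = 0" using lie lie_bracket_iff_insertion[OF \<mu>] by simp
  have sum: "insertion 2 2 (\<mu> + \<nu>) (\<mu> + \<nu>)
      = insertion 2 2 \<mu> \<nu> + insertion 2 2 \<nu> \<mu> + insertion 2 2 \<nu> \<nu>"
    using zero
    by (simp add: insertion_add_left insertion_add_right[of \<mu>, OF cochains_add_head[OF \<mu>]]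
        insertion_add_right[of \<nu>, OF cochains_add_head[OF \<nu>]])
  let ?K = "- insertion 2 2 (\<mu> + \<nu>) (\<mu> + \<nu>)"
  have pw: "?K xs = (- insertion 2 2 \<mu> \<nu> - insertion 2 2 \<nu> \<mu>) xs
      + (1 / 2) *\<^sub>R (- insertion 2 2 \<nu> \<nu> - insertion 2 2 \<nu> \<nu>) xs" for xs
  proof -
    have "(1 / 2) *\<^sub>R (- a - a) = - a" for a :: 'a
      using scaleR_half_double[of "- a"] by simp
    then show ?thesis by (simp add: sum)
  qed
  have "gla_bracket 1 1 (Theta \<mu>) (Theta \<nu>)
      + (1 / 2) *\<^sub>R gla_bracket 1 1 (Theta \<nu>) (Theta \<nu>)
    = (?K, \<lambda>xs. if length xs = 2 then \<lambda>z. ?K (xs @ [z]) else 0)"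
    unfolding gla_bracket_Theta[OF \<mu> \<nu>] gla_bracket_Theta[OF \<nu> \<nu>]
    by (auto simp: fun_eq_iff pw simp del: uminus_apply fun_diff_def minus_apply)
  also have "\<dots> = 0 \<longleftrightarrow> ?K = 0"
    by (auto simp: prod_eq_iff fun_eq_iff)
  also have "\<dots> \<longleftrightarrow> lie_bracket (\<mu> + \<nu>)"
    using lie_bracket_iff_insertion[OF cochains_UNIV_add[OF \<mu> \<nu>]] by simp
  finally show ?thesis .
qed


section \<open>Bracketing with a constant endomorphism\<close>

lemma gla_bracket_cochain0:
  fixes A :: "'g::real_vector \<Rightarrow> 'g"
  assumes \<xi>: "\<And>r. \<xi> (0 # r) = 0" and \<eta>: "\<And>r. \<eta> (0 # r) = 0"
  shows "gla_bracket 1 0 (\<xi>, \<eta>) (0, cochain0 A)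
    = (0, \<lambda>xs. if length xs = 1 then (\<eta> xs \<circ> A) - (A \<circ> \<eta> xs) else 0)"
proof -
  have "gla_bracket 1 0 (\<xi>, \<eta>) (0, cochain0 A)
      = (0, gl_comp 1 0 \<eta> (cochain0 A) - gl_comp 0 1 (cochain0 A) \<eta>)"
    by (simp add: gla_bracket_def koszul_def gla_mixed_def insertion_zero_left
        insertion_zero_right[of \<xi>, OF \<xi>] insertion_zero_right[of \<eta>, OF \<eta>])
  also have "gl_comp 1 0 \<eta> (cochain0 A) - gl_comp 0 1 (cochain0 A) \<eta>
      = (\<lambda>xs. if length xs = 1 then (\<eta> xs \<circ> A) - (A \<circ> \<eta> xs) else 0)"
  proof
    fix xs :: "'g list"
    show "(gl_comp 1 0 \<eta> (cochain0 A) - gl_comp 0 1 (cochain0 A) \<eta>) xs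
      = (if length xs = 1 then (\<eta> xs \<circ> A) - (A \<circ> \<eta> xs) else 0)"
    proof (cases "length xs = 1")
      case True
      then obtain x where "xs = [x]" using length_1_cases by auto
      then show ?thesis by (simp add: gl_comp_1_0[unfolded One_nat_def]
            gl_comp_0_1[unfolded One_nat_def] cochain0_def)
    next
      case False
      then show ?thesis by (simp add: gl_comp_wrong_length)
    qed
  qed
  finally show ?thesis .
qed

lemma incl_I_cochain0:
  assumes "linear \<sigma>"
  shows "incl_I \<pi> \<sigma> (cochain0 \<phi>) = (0, cochain0 (\<lambda>y. \<sigma> (\<phi> (pr_split \<pi> \<sigma> y))))"
  using linear_0[OF assms] by (auto simp: incl_I_def cochain0_def fun_eq_iff)


section \<open>Graphs over the ideal\<close>

lemma pr_split_in_kernel: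
  assumes "quotient_projection I \<pi>" "linear_splitting \<pi> \<sigma>"
  shows "pr_split \<pi> \<sigma> y \<in> I"
  using assms by (auto simp: quotient_projection_def linear_splitting_def linear_diff pr_split_def)

text \<open>
  The graph is the solution set of an equation between linear maps on the whole space. This holds
  because \<open>y = pr(y) + \<sigma>(\<pi>(y))\<close>.
\<close>

lemma graph_eq:
  assumes "quotient_projection I \<pi>" "linear_splitting \<pi> \<sigma>"
  shows "{u + \<sigma> (\<phi> u) | u. u \<in> I} = {y. \<pi> y = \<phi> (pr_split \<pi> \<sigma> y)}"
proof -
  have \<pi>: "linear \<pi>" "\<And>x. x \<in> I \<longleftrightarrow> \<pi> x = 0" and \<sigma>: "\<And>q. \<pi> (\<sigma> q) = q"
    using assms by (auto simp: quotient_projection_def linear_splitting_def)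
  have 1: "\<pi> (u + \<sigma> (\<phi> u)) = \<phi> u" "pr_split \<pi> \<sigma> (u + \<sigma> (\<phi> u)) = u" if "u \<in> I" for u
    using that \<pi> \<sigma> by (auto simp: linear_add pr_split_def)
  have 2: "y = pr_split \<pi> \<sigma> y + \<sigma> (\<pi> y)" for y by (simp add: pr_split_def)
  show ?thesis
    using 1 by auto (metis 2 pr_split_in_kernel[OF assms])
qed

lemma linear_phi_pr_split:
  assumes "quotient_projection I \<pi>" "linear_splitting \<pi> \<sigma>" "\<phi> \<in> hom_from I"
  shows "linear (\<lambda>y. \<phi> (pr_split \<pi> \<sigma> y))"
proof -
  have \<pi>: "linear \<pi>" "\<And>x. x \<in> I \<longleftrightarrow> \<pi> x = 0" and \<sigma>: "linear \<sigma>" "\<And>q. \<pi> (\<sigma> q) = q"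
    using assms by (auto simp: quotient_projection_def linear_splitting_def)
  have "pr_split \<pi> \<sigma> y \<in> I" for y
    by (rule pr_split_in_kernel[OF assms(1,2)])
  moreover have "pr_split \<pi> \<sigma> (x + y) = pr_split \<pi> \<sigma> x + pr_split \<pi> \<sigma> y"
    "pr_split \<pi> \<sigma> (c *\<^sub>R x) = c *\<^sub>R pr_split \<pi> \<sigma> x" for x y c
    using \<pi> \<sigma> by (auto simp: pr_split_def linear_add linear_scale scaleR_diff_right)
  ultimately show ?thesis
    using assms(3) by (intro linearI) (auto simp: hom_from_def)
qed

lemma phi_pr_split_splitting:
  assumes "quotient_projection I \<pi>" "linear_splitting \<pi> \<sigma>" "\<phi> \<in> hom_from I"
  shows "\<phi> (pr_split \<pi> \<sigma> (\<sigma> q)) = 0"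
proof -
  have "pr_split \<pi> \<sigma> (\<sigma> q) = pr_split \<pi> \<sigma> 0"
    using assms(1,2)
    by (simp add: quotient_projection_def linear_splitting_def pr_split_def linear_0)
  then show ?thesis using linear_0[OF linear_phi_pr_split[OF assms]] by simp
qed

lemma graph_complement:
  assumes "quotient_projection I \<pi>" "linear_splitting \<pi> \<sigma>" "\<phi> \<in> hom_from I"
  shows "direct_sum_decomposition {u + \<sigma> (\<phi> u) | u. u \<in> I} (range \<sigma>)"
proof -
  have \<pi>: "linear \<pi>" and \<sigma>: "linear \<sigma>" "\<And>q. \<pi> (\<sigma> q) = q"
    using assms by (auto simp: quotient_projection_def linear_splitting_def)
  define \<psi> where "\<psi> y = \<phi> (pr_split \<pi> \<sigma> y)" for y
  have \<psi>: "linear \<psi>" unfolding \<psi>_def by (rule linear_phi_pr_split[OF assms])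
  have \<psi>\<sigma>: "\<psi> (\<sigma> q) = 0" for q
    unfolding \<psi>_def by (rule phi_pr_split_splitting[OF assms])
  let ?G = "{y. \<pi> y = \<psi> y}"
  have "subspace ?G"
    using \<pi> \<psi> by (auto simp: subspace_def linear_0 linear_add linear_scale)
  moreover have "subspace (range \<sigma>)"
    using linear_subspace_image[OF \<sigma>(1) subspace_UNIV] .
  moreover have "?G \<inter> range \<sigma> = {0}"
    using \<sigma> \<psi>\<sigma> linear_0[OF \<pi>] linear_0[OF \<psi>] linear_0[OF \<sigma>(1)] by (auto intro: range_eqI[of _ _ 0])
  moreover have "y \<in> {u + v | u v. u \<in> ?G \<and> v \<in> range \<sigma>}" for y
  proof -
    \<comment> \<open>the component along \<open>\<sigma>\<close> is the defect of \<open>y\<close> in the equation of the graph\<close>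
    let ?v = "\<sigma> (\<pi> y - \<psi> y)"
    have "\<pi> (y - ?v) = \<psi> (y - ?v)"
      using \<pi> \<sigma> \<psi> \<psi>\<sigma> by (simp add: linear_diff)
    moreover have "y = (y - ?v) + ?v" by simp
    ultimately show ?thesis by blast
  qed
  ultimately show ?thesis
    unfolding direct_sum_decomposition_def graph_eq[OF assms(1,2)] \<psi>_def by blast
qed


section \<open>The equation in the module part\<close>

lemma bracket_IP_Theta:
  assumes \<alpha>: "\<alpha> \<in> cochains 2 UNIV" and \<sigma>: "linear_splitting \<pi> \<sigma>" and \<pi>: "linear \<pi>" and u: "u \<in> I"
  shows "bracket_IP I \<pi> \<sigma> 1 0 (Theta \<alpha>) (cochain0 \<phi>) [x] u
    = \<pi> (\<alpha> [x, \<sigma> (\<phi> (pr_split \<pi> \<sigma> u))]) - \<phi> (pr_split \<pi> \<sigma> (\<alpha> [x, u]))"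
proof -
  have l: "linear \<sigma>" and s: "\<And>q. \<pi> (\<sigma> q) = q" using \<sigma> by (auto simp: linear_splitting_def)
  let ?A = "\<lambda>y. \<sigma> (\<phi> (pr_split \<pi> \<sigma> y))"
  let ?ad = "adjoint_cochain \<alpha>"
  have "gla_bracket 1 0 (Theta \<alpha>) (0, cochain0 ?A)
      = (0, \<lambda>xs. if length xs = 1 then (?ad xs \<circ> ?A) - (?A \<circ> ?ad xs) else 0)"
    unfolding Theta_def
    by (rule gla_bracket_cochain0)
      (rule cochains_zero_head[OF \<alpha>] cochains_zero_head[OF adjoint_cochain_in_cochains[OF \<alpha>]])+
  then show ?thesis
    unfolding bracket_IP_def incl_I_cochain0[OF l]
    by (simp add: proj_P_def u adjoint_cochain_def linear_diff[OF \<pi>] s)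
qed

text \<open>
  Of the four terms of the double commutator with \<open>A = \<sigma> \<circ> \<phi> \<circ> pr\<close>, the two that contain
  \<open>A \<circ> A\<close> vanish, because \<open>pr\<close> is 0 on the image of \<open>\<sigma>\<close>; the other two are equal.
\<close>

lemma bracket_IIP_Theta:
  assumes \<alpha>: "\<alpha> \<in> cochains 2 UNIV" and q: "quotient_projection I \<pi>"
    and \<sigma>: "linear_splitting \<pi> \<sigma>" and \<phi>: "\<phi> \<in> hom_from I" and u: "u \<in> I"
  shows "bracket_IIP I \<pi> \<sigma> 1 0 0 (Theta \<alpha>) (cochain0 \<phi>) (cochain0 \<phi>) [x] u
    = - 2 *\<^sub>R \<phi> (pr_split \<pi> \<sigma> (\<alpha> [x, \<sigma> (\<phi> (pr_split \<pi> \<sigma> u))]))"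
proof -
  have l: "linear \<sigma>" and s: "\<And>q. \<pi> (\<sigma> q) = q" using \<sigma> by (auto simp: linear_splitting_def)
  have \<pi>: "linear \<pi>" using q by (simp add: quotient_projection_def)
  define \<psi> where "\<psi> y = \<phi> (pr_split \<pi> \<sigma> y)" for y
  have \<psi>: "linear \<psi>" unfolding \<psi>_def by (rule linear_phi_pr_split[OF q \<sigma> \<phi>])
  have \<psi>\<sigma>: "\<psi> (\<sigma> p) = 0" for p
    unfolding \<psi>_def by (rule phi_pr_split_splitting[OF q \<sigma> \<phi>])
  let ?A = "\<lambda>y. \<sigma> (\<psi> y)"
  let ?ad = "adjoint_cochain \<alpha>"
  let ?C = "\<lambda>xs. if length xs = 1 then (?ad xs \<circ> ?A) - (?A \<circ> ?ad xs) else 0"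
  have ad0: "?ad (0 # r) = 0" for r
    by (rule cochains_zero_head[OF adjoint_cochain_in_cochains[OF \<alpha>]])
  have incl: "incl_I \<pi> \<sigma> (cochain0 \<phi>) = (0, cochain0 ?A)"
    unfolding \<psi>_def by (rule incl_I_cochain0[OF l])
  have one: "gla_bracket 1 0 (Theta \<alpha>) (0, cochain0 ?A) = (0, ?C)"
    unfolding Theta_def 
    by (rule gla_bracket_cochain0) (rule cochains_zero_head[OF \<alpha>] ad0)+
  have two: "gla_bracket 1 0 (0, ?C) (0, cochain0 ?A)
      = (0, \<lambda>xs. if length xs = 1 then (?C xs \<circ> ?A) - (?A \<circ> ?C xs) else 0)"
  proof (rule gla_bracket_cochain0)
    show "?C (0 # r) = 0" for r
      using linear_0[OF l] linear_0[OF \<psi>] by (simp add: ad0 fun_eq_iff zero_fun_def)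
  qed simp
  have \<alpha>0: "\<alpha> [x, 0] = 0" using linear_0[OF cochains_2_linear_right[OF \<alpha>]] .
  have "bracket_IIP I \<pi> \<sigma> 1 0 0 (Theta \<alpha>) (cochain0 \<phi>) (cochain0 \<phi>) [x] u
      = \<pi> (((?C [x] \<circ> ?A) - (?A \<circ> ?C [x])) u)"
    unfolding bracket_IIP_def incl by (simp add: one two[simplified] proj_P_def u)
  also have "\<dots> = - \<psi> (\<alpha> [x, ?A u]) - \<psi> (\<alpha> [x, ?A u])"
    by (simp add: adjoint_cochain_def linear_diff[OF \<pi>] linear_diff[OF \<psi>] linear_0[OF \<pi>] linear_neg[OF \<pi>]
        linear_0[OF l] \<psi>\<sigma> \<alpha>0 s)
  also have "\<dots> = - 2 *\<^sub>R \<psi> (\<alpha> [x, ?A u])"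
    by (simp add: scaleR_2)
  finally show ?thesis by (simp add: \<psi>_def)
qed

lemma proj_P_eq_0:
  assumes "linear \<pi>" "snd y xs = 0"
  shows "proj_P I \<pi> y xs = 0"
  using assms linear_0 by (auto simp: proj_P_def fun_eq_iff)

lemma brackets_Theta_wrong_length:
  assumes \<alpha>: "\<alpha> \<in> cochains 2 UNIV" and \<sigma>: "linear \<sigma>" and \<pi>: "linear \<pi>" and xs: "length xs \<noteq> 1"
  shows "bracket_IP I \<pi> \<sigma> 1 0 (Theta \<alpha>) (cochain0 \<phi>) xs = 0"
    and "bracket_IIP I \<pi> \<sigma> 1 0 0 (Theta \<alpha>) (cochain0 \<phi>) (cochain0 \<phi>) xs = 0"
    and "proj_P I \<pi> (Theta \<alpha>) xs = 0"
proof -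
  have *: "snd (gla_bracket 1 0 y (incl_I \<pi> \<sigma> (cochain0 \<phi>))) xs = 0" for y
    using xs by (cases y) (simp add: gla_bracket_def gla_mixed_def incl_I_cochain0[OF \<sigma>]
        insertion_wrong_length gl_comp_wrong_length)
  show "bracket_IP I \<pi> \<sigma> 1 0 (Theta \<alpha>) (cochain0 \<phi>) xs = 0"
    and "bracket_IIP I \<pi> \<sigma> 1 0 0 (Theta \<alpha>) (cochain0 \<phi>) (cochain0 \<phi>) xs = 0"
    unfolding bracket_IP_def bracket_IIP_def add_0_right by (rule proj_P_eq_0[OF \<pi> *])+
  show "proj_P I \<pi> (Theta \<alpha>) xs = 0"
    using xs by (intro proj_P_eq_0[OF \<pi>]) (simp add: Theta_def adjoint_cochain_def)
qed

text \<open>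
  The left-hand side, evaluated at \<open>x\<close> and \<open>u\<close>, is the defect of \<open>(\<mu> + \<nu>)(x, u + \<sigma>(\<phi>(u)))\<close> in
  the equation of the graph. Only \<open>\<nu>\<close> enters the first term, since \<open>\<pi>(\<mu>(x, u)) = 0\<close>.
\<close>

lemma graph_equation_iff:
  assumes \<mu>: "\<mu> \<in> cochains 2 UNIV" and \<nu>: "\<nu> \<in> cochains 2 UNIV"
    and ideal: "lie_ideal \<mu> I" and q: "quotient_projection I \<pi>"
    and \<sigma>: "linear_splitting \<pi> \<sigma>" and \<phi>: "\<phi> \<in> hom_from I"
  shows "proj_P I \<pi> (Theta \<nu>)
      + bracket_IP I \<pi> \<sigma> 1 0 (Theta \<mu>) (cochain0 \<phi>)
      + bracket_IP I \<pi> \<sigma> 1 0 (Theta \<nu>) (cochain0 \<phi>)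
      + (1 / 2) *\<^sub>R bracket_IIP I \<pi> \<sigma> 1 0 0 (Theta \<mu>) (cochain0 \<phi>) (cochain0 \<phi>)
      + (1 / 2) *\<^sub>R bracket_IIP I \<pi> \<sigma> 1 0 0 (Theta \<nu>) (cochain0 \<phi>) (cochain0 \<phi>) = 0
    \<longleftrightarrow> lie_ideal (\<mu> + \<nu>) {u + \<sigma> (\<phi> u) | u. u \<in> I}" (is "?E = 0 \<longleftrightarrow> lie_ideal _ ?G")
proof -
  have l: "linear \<sigma>" and s: "\<And>q. \<pi> (\<sigma> q) = q" using \<sigma> by (auto simp: linear_splitting_def)
  have \<pi>: "linear \<pi>" and I: "\<And>y. y \<in> I \<longleftrightarrow> \<pi> y = 0"
    using q by (auto simp: quotient_projection_def)
  define \<psi> where "\<psi> y = \<phi> (pr_split \<pi> \<sigma> y)" for y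
  have \<psi>: "linear \<psi>" unfolding \<psi>_def by (rule linear_phi_pr_split[OF q \<sigma> \<phi>])
  have pr: "pr_split \<pi> \<sigma> u = u" if "u \<in> I" for u
    using that I linear_0[OF l] by (simp add: pr_split_def)
  have E: "?E [x] u = \<pi> ((\<mu> + \<nu>) [x, u + \<sigma> (\<phi> u)]) - \<psi> ((\<mu> + \<nu>) [x, u + \<sigma> (\<phi> u)])"
    if u: "u \<in> I" for x u
  proof -
    have "\<pi> (\<mu> [x, u]) = 0" using ideal u I by (auto simp: lie_ideal_def)
    moreover have "proj_P I \<pi> (Theta \<nu>) [x] u = \<pi> (\<nu> [x, u])"
      using u by (simp add: proj_P_def Theta_def adjoint_cochain_def)
    ultimately show ?thesis
      using u
      by (simp add: bracket_IP_Theta[OF _ \<sigma> \<pi>] bracket_IIP_Theta[OF _ q \<sigma> \<phi>] \<mu> \<nu> pr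
          linear_add[OF cochains_2_linear_right[OF \<mu>]] linear_add[OF cochains_2_linear_right[OF \<nu>]]
          linear_add[OF \<pi>] linear_add[OF \<psi>] flip: \<psi>_def)
  qed
  have outside: "?E xs u = 0" if "length xs \<noteq> 1 \<or> u \<notin> I" for xs u
    using that
  proof
    assume "length xs \<noteq> 1"
    then show ?thesis by (simp add: brackets_Theta_wrong_length[OF _ l \<pi>] \<mu> \<nu>)
  next
    assume "u \<notin> I"
    then show ?thesis by (simp add: proj_P_def bracket_IP_def bracket_IIP_def)
  qed
  have sub: "subspace ?G"
    using graph_complement[OF q \<sigma> \<phi>] by (simp add: direct_sum_decomposition_def)
  have memG: "y \<in> ?G \<longleftrightarrow> \<pi> y = \<psi> y" for y
    unfolding graph_eq[OF q \<sigma>] \<psi>_def by simp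
  have "?E = 0 \<longleftrightarrow> (\<forall>x. \<forall>u\<in>I. ?E [x] u = 0)" (is "_ \<longleftrightarrow> ?R")
  proof
    assume R: ?R
    have "?E xs u = 0" for xs u
      using R outside[of xs u] length_1_cases[of xs] by (metis One_nat_def)
    then show "?E = 0" by (simp only: fun_eq_iff zero_fun_def simp_thms)
  next
    assume "?E = 0"
    then show ?R by (simp only: zero_fun_def simp_thms ball_triv)
  qed
  also have "\<dots> \<longleftrightarrow> (\<forall>x. \<forall>u\<in>I. (\<mu> + \<nu>) [x, u + \<sigma> (\<phi> u)] \<in> ?G)"
    using E memG by (metis (no_types, lifting) eq_iff_diff_eq_0)
  also have "\<dots> \<longleftrightarrow> lie_ideal (\<mu> + \<nu>) ?G"
    unfolding lie_ideal_def using sub by blast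
  finally show ?thesis .
qed


section \<open>The Maurer--Cartan equation\<close>

lemma maurer_cartan_Theta_iff:
  fixes \<phi> :: "'g::real_vector \<Rightarrow> 'q::real_vector"
  assumes \<nu>: "\<nu> \<in> cochains 2 UNIV" and \<phi>: "\<phi> \<in> hom_from I"
  shows "maurer_cartan \<mu> I \<pi> \<sigma> (Theta \<nu>, cochain0 \<phi>) \<longleftrightarrow>
    gla_bracket 1 1 (Theta \<mu>) (Theta \<nu>)
      + (1 / 2) *\<^sub>R gla_bracket 1 1 (Theta \<nu>) (Theta \<nu>) = 0 \<and>
    proj_P I \<pi> (Theta \<nu>)
      + bracket_IP I \<pi> \<sigma> 1 0 (Theta \<mu>) (cochain0 \<phi>)
      + bracket_IP I \<pi> \<sigma> 1 0 (Theta \<nu>) (cochain0 \<phi>)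
      + (1 / 2) *\<^sub>R bracket_IIP I \<pi> \<sigma> 1 0 0 (Theta \<mu>) (cochain0 \<phi>) (cochain0 \<phi>)
      + (1 / 2) *\<^sub>R bracket_IIP I \<pi> \<sigma> 1 0 0 (Theta \<nu>) (cochain0 \<phi>) (cochain0 \<phi>) = 0"
proof -
  have "0 \<in> hom_from I" by (simp add: hom_from_def)
  then have deg: "(Theta \<nu>, cochain0 \<phi>) \<in> linf_degree I 0"
    using \<nu> adjoint_cochain_in_cochains[OF \<nu>] cochain0_in_cochains[OF \<phi>]
    by (simp add: linf_degree_def gla_degree_def Theta_def)
  let ?T = "gla_bracket 1 1 (Theta \<mu>) (Theta \<nu>)" and ?N = "gla_bracket 1 1 (Theta \<nu>) (Theta \<nu>)"
    and ?P = "proj_P I \<pi> (Theta \<nu>)"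
    and ?a = "bracket_IP I \<pi> \<sigma> 1 0 (Theta \<mu>) (cochain0 \<phi>)"
    and ?b = "bracket_IP I \<pi> \<sigma> 1 0 (Theta \<nu>) (cochain0 \<phi>)"
    and ?c = "bracket_IIP I \<pi> \<sigma> 1 0 0 (Theta \<mu>) (cochain0 \<phi>) (cochain0 \<phi>)"
    and ?d = "bracket_IIP I \<pi> \<sigma> 1 0 0 (Theta \<nu>) (cochain0 \<phi>) (cochain0 \<phi>)"
  have "(1 / 2) *\<^sub>R (v + v + w) = v + (1 / 2) *\<^sub>R w"
    "(1 / 6) *\<^sub>R (v + v + v) = (1 / 2) *\<^sub>R v" for v w :: "'g list \<Rightarrow> 'g \<Rightarrow> 'q"
    using scaleR_half_double[of v]
    by (simp_all add: scaleR_add_right flip: scaleR_left.add)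
  then have eq: "linf_m1 \<mu> I \<pi> \<sigma> 0 (Theta \<nu>, cochain0 \<phi>)
      + (1 / 2) *\<^sub>R linf_m2 \<mu> I \<pi> \<sigma> 0 0 (Theta \<nu>, cochain0 \<phi>) (Theta \<nu>, cochain0 \<phi>)
      + (1 / 6) *\<^sub>R linf_m3 I \<pi> \<sigma> 0 0 0 (Theta \<nu>, cochain0 \<phi>) (Theta \<nu>, cochain0 \<phi>)
          (Theta \<nu>, cochain0 \<phi>)
    = (- (?T + (1 / 2) *\<^sub>R ?N), ?P + ?a + ?b + (1 / 2) *\<^sub>R ?c + (1 / 2) *\<^sub>R ?d)"
    by (simp add: linf_m1_def linf_m2_def linf_m3_def m1_def m2_def koszul_def
        bracket_IP_def[of _ _ _ _ _ "Theta \<mu>"] add.assoc)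
  have zero: "(- t, e) = 0 \<longleftrightarrow> t = 0 \<and> e = 0"
    for t :: "'g gla" and e :: "'g list \<Rightarrow> 'g \<Rightarrow> 'q"
    unfolding prod_eq_iff[of "(- t, e)"]
    by (simp only: fst_conv snd_conv fst_zero snd_zero neg_equal_0_iff_equal)
  show ?thesis
    unfolding maurer_cartan_def eq zero using deg by (simp only: simp_thms)
qed

theorem theorem5p8:
  fixes \<mu> \<mu>' :: "'g::real_vector list \<Rightarrow> 'g"
    and I :: "'g set"
    and \<pi> :: "'g \<Rightarrow> 'q::real_vector"
    and \<sigma> :: "'q \<Rightarrow> 'g"
    and \<phi> :: "'g \<Rightarrow> 'q"
  assumes "\<exists>B :: 'g set. finite B \<and> span B = UNIV"
    and "lie_bracket \<mu>"
    and "lie_ideal \<mu> I"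
    and "quotient_projection I \<pi>"
    and "linear_splitting \<pi> \<sigma>"
    and "\<phi> \<in> hom_from I"
    and "\<mu>' \<in> cochains 2 UNIV"
  shows "simultaneous_small_deformation \<mu> \<sigma> \<mu>' {u + \<sigma> (\<phi> u) | u. u \<in> I} \<longleftrightarrow>
    maurer_cartan \<mu> I \<pi> \<sigma> ((\<mu>', adjoint_cochain \<mu>'), cochain0 \<phi>)"
proof -
  have \<mu>: "\<mu> \<in> cochains 2 UNIV" using assms(2) by (simp add: lie_bracket_def)
  have dec: "direct_sum_decomposition {u + \<sigma> (\<phi> u) | u. u \<in> I} (range \<sigma>)"
    by (rule graph_complement[OF assms(4-6)])
  then have "subspace {u + \<sigma> (\<phi> u) | u. u \<in> I}"
    by (simp add: direct_sum_decomposition_def)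
  then have "simultaneous_small_deformation \<mu> \<sigma> \<mu>' {u + \<sigma> (\<phi> u) | u. u \<in> I} \<longleftrightarrow>
      lie_bracket (\<mu> + \<mu>') \<and> lie_ideal (\<mu> + \<mu>') {u + \<sigma> (\<phi> u) | u. u \<in> I}"
    using dec assms(7) by (simp add: simultaneous_small_deformation_def)
  also have "\<dots> \<longleftrightarrow> maurer_cartan \<mu> I \<pi> \<sigma> (Theta \<mu>', cochain0 \<phi>)"
    unfolding maurer_cartan_Theta_iff[OF assms(7,6)] structure_equation_iff[OF assms(2,7)]
      graph_equation_iff[OF \<mu> assms(7,3-6)] ..
  finally show ?thesis by (simp add: Theta_def)
qed

end
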